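(* Let $A:\mathbb{R}^d\to\mathbb{R}^m$ be a linear map that has no singular value of multiplicity $d-1$ or $d$, and let $(v^k)_{k\in\mathbb{N}}$ be the sequence of random variables generated by the algorithm described in the context. Then for every integer $n\ge 0$ and every $\varepsilon>0$, $$\min_{0\le k\le n}\mathbb{P}\Bigl(\bigl\|A^*Av^k-\|Av^k\|^2v^k\bigr\|^2\ge\varepsilon\Bigr)\le\frac{2(d-1)\|A\|^4}{(n+1)\,\varepsilon}.$$
   Context: $\|\cdot\|$ and $\langle\cdot,\cdot\rangle$ are the standard Euclidean norm and inner product; for a linear map, $\|A\|$ is the induced operator norm and $A^*$ the adjoint. The singular values of $A$ are the nonnegative square roots of the eigenvalues of $A^*A$ (zero included); the multiplicity of a singular value $\sigma$ is the dimension of the eigenspace of $A^*A$ for $\sigma^2$. Algorithm: Draw $\hat v\sim\mathcal{N}(0,I_d)$ and set $v^0=\hat v/\|\hat v\|$. For $k=0,1,2,\dots$: sample $y^k\sim\mathcal{N}(0,I_d)$ (independently of everything before); set $x^k=\dfrac{y^k-\langle y^k,v^k\rangle v^k}{\|y^k-\langle y^k,v^k\rangle v^k\|}$; set $a_k=\langle Av^k,Ax^k\rangle$ and $b_k=\|Ax^k\|^2-\|Av^k\|^2$; set $\tau_k=\operatorname{sign}(a_k)\left(\frac{b_k}{2|a_k|}+\sqrt{\frac{b_k^2}{4a_k^2}+1}\right)$; set $v^{k+1}=\dfrac{v^k+\tau_kx^k}{\sqrt{1+\tau_k^2}}$. The step is undefined if $a_k=0$, but under the stated multiplicity assumption this happens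 with probability zero, so the sequence is almost surely well defined. *)

theory Defs
  imports "HOL-Probability.Probability"
begin

text \<open>Singular values of a linear map and their multiplicities, via \<open>A\<^sup>* A\<close>.\<close>

definition singular_value ::
    "('a::euclidean_space \<Rightarrow> 'b::euclidean_space) \<Rightarrow> real \<Rightarrow> bool" where
  "singular_value A \<sigma> \<longleftrightarrow>
     \<sigma> \<ge> 0 \<and> (\<exists>u. u \<noteq> 0 \<and> adjoint A (A u) = \<sigma>\<^sup>2 *\<^sub>R u)"

definition singular_value_multiplicity ::
    "('a::euclidean_space \<Rightarrow> 'b::euclidean_space) \<Rightarrow> real \<Rightarrow> nat" where
  "singular_value_multiplicity A \<sigma> = dim {u. adjoint A (A u) = \<sigma>\<^sup>2 *\<^sub>R u}"

definition std_gaussian_density :: "real ^ 'd \<Rightarrow> real" where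
  "std_gaussian_density z = exp (- (norm z)\<^sup>2 / 2) / sqrt ((2 * pi) ^ CARD('d))"

lemma std_gaussian_density_eq_prod:
  "std_gaussian_density z = (\<Prod>i\<in>UNIV. std_normal_density (z $ i))"
proof -
  have "(norm z)\<^sup>2 = (\<Sum>i\<in>UNIV. (z $ i)\<^sup>2)"
    by (simp add: norm_vec_def L2_set_def sum_nonneg)
  then show ?thesis
    by (simp add: std_gaussian_density_def std_normal_density_def prod.distrib
        exp_sum[symmetric] sum_negf sum_divide_distrib real_sqrt_power real_sqrt_mult
        power_mult_distrib prod_dividef)
qed

definition std_gaussian :: "'w measure \<Rightarrow> ('w \<Rightarrow> real ^ 'd) \<Rightarrow> bool" where
  "std_gaussian M Z \<longleftrightarrow> distributed M lborel Z (\<lambda>z. ennreal (std_gaussian_density z))"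

definition alg_x :: "real ^ 'd \<Rightarrow> real ^ 'd \<Rightarrow> real ^ 'd" where
  "alg_x v y = (y - (y \<bullet> v) *\<^sub>R v) /\<^sub>R norm (y - (y \<bullet> v) *\<^sub>R v)"

definition alg_a :: "(real ^ 'd \<Rightarrow> real ^ 'm) \<Rightarrow> real ^ 'd \<Rightarrow> real ^ 'd \<Rightarrow> real" where
  "alg_a A v x = A v \<bullet> A x"

definition alg_b :: "(real ^ 'd \<Rightarrow> real ^ 'm) \<Rightarrow> real ^ 'd \<Rightarrow> real ^ 'd \<Rightarrow> real" where
  "alg_b A v x = (norm (A x))\<^sup>2 - (norm (A v))\<^sup>2"

definition alg_tau :: "real \<Rightarrow> real \<Rightarrow> real" where
  "alg_tau a b = sgn a * (b / (2 * \<bar>a\<bar>) + sqrt (b\<^sup>2 / (4 * a\<^sup>2) + 1))"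

definition alg_next :: "(real ^ 'd \<Rightarrow> real ^ 'm) \<Rightarrow> real ^ 'd \<Rightarrow> real ^ 'd \<Rightarrow> real ^ 'd" where
  "alg_next A v x =
     (let \<tau> = alg_tau (alg_a A v x) (alg_b A v x)
      in (v + \<tau> *\<^sub>R x) /\<^sub>R sqrt (1 + \<tau>\<^sup>2))"

text \<open>
  \<open>v\<close> is a sequence of random variables generated by the algorithm from the Gaussian samples
  \<open>v_hat\<close>, \<open>y 0\<close>, \<open>y 1\<close>, ... A step is constrained only where it is defined: where \<open>a\<^sub>k = 0\<close>
  (which includes the case that the denominator of \<open>x\<^sup>k\<close> vanishes, as then \<open>alg_x\<close> is \<open>0\<close>)
  the value of \<open>v (Suc k)\<close> is arbitrary, so that no convention on division by zero enters.
\<close>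

definition generated_by_algorithm ::
    "(real ^ 'd \<Rightarrow> real ^ 'm) \<Rightarrow> 'w measure \<Rightarrow> ('w \<Rightarrow> real ^ 'd) \<Rightarrow> (nat \<Rightarrow> 'w \<Rightarrow> real ^ 'd) \<Rightarrow>
     (nat \<Rightarrow> 'w \<Rightarrow> real ^ 'd) \<Rightarrow> bool" where
  "generated_by_algorithm A M v_hat y v \<longleftrightarrow>
     std_gaussian M v_hat \<and>
     (\<forall>k. std_gaussian M (y k)) \<and>
     prob_space.indep_vars M (\<lambda>_. borel) (case_nat v_hat y) UNIV \<and>
     (\<forall>k. v k \<in> borel_measurable M) \<and>
     (\<forall>\<omega>\<in>space M. v_hat \<omega> \<noteq> 0 \<longrightarrow> v 0 \<omega> = v_hat \<omega> /\<^sub>R norm (v_hat \<omega>)) \<and>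
     (\<forall>k. \<forall>\<omega>\<in>space M.
        let x = alg_x (v k \<omega>) (y k \<omega>)
        in alg_a A (v k \<omega>) x \<noteq> 0 \<longrightarrow> v (Suc k) \<omega> = alg_next A (v k \<omega>) x)"

end

theory Submission imports Defs begin

text \<open>
  Write \<open>g v = A\<^sup>* A v - \<parallel>A v\<parallel>\<^sup>2 v\<close>, so that \<open>a\<^sub>k = \<langle>g v\<^sup>k, x\<^sup>k\<rangle>\<close>. The step
  increases \<open>\<parallel>A v\<parallel>\<^sup>2\<close> by \<open>a\<^sub>k \<tau>\<^sub>k \<ge> a\<^sub>k\<^sup>2 / \<parallel>A\<parallel>\<^sup>2\<close>. Given \<open>v\<^sup>k\<close>, the direction \<open>x\<^sup>k\<close> is uniform on
  the unit sphere of the orthogonal complement of \<open>v\<^sup>k\<close>, hence \<open>a\<^sub>k\<^sup>2\<close> has mean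
  \<open>\<parallel>g v\<^sup>k\<parallel>\<^sup>2 / (d - 1)\<close>. Telescoping bounds the sum of the means of \<open>\<parallel>g v\<^sup>k\<parallel>\<^sup>2\<close> by
  \<open>(d - 1) \<parallel>A\<parallel>\<^sup>4\<close>, and Markov's inequality concludes, with a factor 2 to spare. Since every
  eigenspace of \<open>A\<^sup>* A\<close> has codimension at least 2, almost surely no iterate is an eigenvector, so
  that all steps are defined.
\<close>

section \<open>One step of the algorithm\<close>

text \<open>On the unit sphere this is half the Riemannian gradient of
  \<open>(norm (A v))\<^sup>2\<close>.\<close>

definition residual :: "('a::euclidean_space \<Rightarrow> 'b::euclidean_space) \<Rightarrow> 'a \<Rightarrow> 'a" where
  "residual A v = adjoint A (A v) - (norm (A v))\<^sup>2 *\<^sub>R v"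

lemma residual_orthogonal:
  assumes "linear A" "norm v = 1"
  shows "residual A v \<bullet> v = 0"
  using assms
  by (simp add: residual_def inner_diff_left adjoint_clauses power2_norm_eq_inner norm_eq_1)

text \<open>After moving \<open>A\<close> across by the adjoint, the subtracted multiple of
  \<open>v\<close> is invisible to \<open>x\<close>.\<close>

lemma inner_image_eq_residual:
  assumes "linear A" "x \<bullet> v = 0"
  shows "A v \<bullet> A x = residual A v \<bullet> x"
  using assms
  by (simp add: residual_def inner_diff_left adjoint_clauses inner_commute[of v])

text \<open>For an eigenvector the residual is both a multiple of \<open>v\<close> and orthogonal to
  \<open>v\<close>, hence zero.\<close>

lemma residual_eq_0_iff_eigenvector:
  assumes "linear A" "norm v = 1"
  shows "residual A v = 0 \<longleftrightarrow> (\<exists>\<alpha>. adjoint A (A v) = \<alpha> *\<^sub>R v)"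
proof
  assume "\<exists>\<alpha>. adjoint A (A v) = \<alpha> *\<^sub>R v"
  then obtain \<alpha> where l: "adjoint A (A v) = \<alpha> *\<^sub>R v" by blast
  then have "residual A v = (\<alpha> - (norm (A v))\<^sup>2) *\<^sub>R v"
    by (simp add: residual_def algebra_simps)
  moreover from this have "\<alpha> - (norm (A v))\<^sup>2 = 0"
    using residual_orthogonal[OF assms] assms(2) by auto
  ultimately show "residual A v = 0" by simp
qed (auto simp: residual_def)

text \<open>Testing the residual against itself turns its squared norm into
  \<open>A v \<bullet> A (residual A v)\<close>, to which Cauchy-Schwarz applies.\<close>

lemma norm_residual_le:
  assumes "linear A" "norm v = 1"
  shows "norm (residual A v) \<le> (onorm A)\<^sup>2"
proof (cases "residual A v = 0")
  case False
  let ?r = "residual A v"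
  have A: "norm (A u) \<le> onorm A * norm u" for u
    using onorm[OF linear_conv_bounded_linear[THEN iffD1, OF assms(1)]] .
  have "norm ?r * norm ?r = A v \<bullet> A ?r"
    using inner_image_eq_residual[OF assms(1) residual_orthogonal[OF assms]]
    by (simp add: power2_norm_eq_inner[symmetric] power2_eq_square)
  also have "\<dots> \<le> norm (A v) * norm (A ?r)" by (rule norm_cauchy_schwarz)
  also have "\<dots> \<le> onorm A * (onorm A * norm ?r)"
    using A[of v] A[of ?r] assms(2) by (intro mult_mono) (auto intro: order_trans[OF norm_ge_zero])
  finally show ?thesis using False by (simp add: power2_eq_square mult.assoc)
qed simp

section \<open>The sampled direction\<close>

lemma alg_x_orthogonal: "norm v = 1 \<Longrightarrow> alg_x v z \<bullet> v = 0"
  by (simp add: alg_x_def inner_diff_left norm_eq_1)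

lemma inner_alg_x:
  assumes "g \<bullet> v = 0"
  shows "g \<bullet> alg_x v z = (g \<bullet> z) / norm (z - (z \<bullet> v) *\<^sub>R v)"
  using assms by (simp add: alg_x_def inner_diff_right divide_inverse_commute)

lemma norm_alg_x_le: "norm (alg_x v z) \<le> 1"
  by (cases "norm (z - (z \<bullet> v) *\<^sub>R v) = 0") (simp_all add: alg_x_def)

lemma norm_alg_x: "alg_x v z \<noteq> 0 \<Longrightarrow> norm (alg_x v z) = 1"
  by (auto simp: alg_x_def)

lemma alg_a_ne_0D:
  assumes "linear A" "alg_a A v (alg_x v z) \<noteq> 0"
  shows "norm (alg_x v z) = 1"
  using assms by (intro norm_alg_x) (auto simp: alg_a_def linear_0)

lemma alg_a_eq_0D:
  assumes "linear A" "norm v = 1" "alg_a A v (alg_x v z) = 0"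
  shows "residual A v \<bullet> z = 0"
proof -
  have "(residual A v \<bullet> z) / norm (z - (z \<bullet> v) *\<^sub>R v) = 0"
    using assms inner_image_eq_residual[OF assms(1) alg_x_orthogonal[OF assms(2), of z]]
    by (simp add: alg_a_def inner_alg_x[OF residual_orthogonal])
  \<comment> \<open>In the second case the quotient is zero because of its denominator;
    \<open>z\<close> is then parallel to \<open>v\<close>, to which the residual is
    orthogonal.\<close>
  then consider "residual A v \<bullet> z = 0" | "z = (z \<bullet> v) *\<^sub>R v" by auto
  then show ?thesis
    by cases (metis residual_orthogonal[OF assms(1,2)] inner_scaleR_right mult_zero_right)+
qed

text \<open>Multiplying by \<open>a\<close> clears the sign and the denominators and leaves the
  larger root of \<open>t\<^sup>2 - b * t = a\<^sup>2\<close>.\<close>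

lemma alg_tau_eq:
  assumes "a \<noteq> 0"
  shows "a * alg_tau a b = b / 2 + sqrt (b\<^sup>2 / 4 + a\<^sup>2)"
proof -
  have "b\<^sup>2 / 4 + a\<^sup>2 = (b\<^sup>2 / (4 * a\<^sup>2) + 1) * a\<^sup>2"
    using assms by (simp add: field_simps)
  then have s: "sqrt (b\<^sup>2 / 4 + a\<^sup>2) = sqrt (b\<^sup>2 / (4 * a\<^sup>2) + 1) * \<bar>a\<bar>"
    by (simp add: real_sqrt_mult)
  have "a * alg_tau a b = \<bar>a\<bar> * (b / (2 * \<bar>a\<bar>) + sqrt (b\<^sup>2 / (4 * a\<^sup>2) + 1))"
    by (simp add: alg_tau_def abs_sgn mult.assoc)
  also have "\<dots> = b / 2 + sqrt (b\<^sup>2 / 4 + a\<^sup>2)"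
    unfolding s using assms by (simp add: distrib_left)
  finally show ?thesis .
qed

lemma alg_tau_root:
  assumes "a \<noteq> 0"
  shows "(a * alg_tau a b) * (a * alg_tau a b - b) = a\<^sup>2"
proof -
  have "(sqrt (b\<^sup>2 / 4 + a\<^sup>2))\<^sup>2 = b\<^sup>2 / 4 + a\<^sup>2" by simp
  then show ?thesis unfolding alg_tau_eq[OF assms]
    by (simp add: power2_eq_square algebra_simps)
qed

lemma norm_add_scaleR_orthonormal:
  fixes v x :: "'a::real_inner"
  assumes "norm v = 1" "norm x = 1" "x \<bullet> v = 0"
  shows "norm (v + t *\<^sub>R x) = sqrt (1 + t\<^sup>2)"
proof -
  have "(norm (v + t *\<^sub>R x))\<^sup>2 = 1 + t\<^sup>2"
    unfolding power2_norm_eq_inner inner_add_left inner_add_right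
    using assms by (simp add: norm_eq_1 inner_commute[of v x] power2_eq_square)
  then show ?thesis by (metis norm_ge_zero real_sqrt_unique)
qed

lemma norm_alg_next:
  assumes "linear A" "norm v = 1" "norm x = 1" "x \<bullet> v = 0"
  shows "norm (alg_next A v x) = 1"
proof -
  have "sqrt (1 + t\<^sup>2) \<noteq> 0" for t :: real using zero_le_power2[of t] by (simp add: add_nonneg_eq_0_iff)
  then show ?thesis
    using norm_add_scaleR_orthonormal[OF assms(2-4)] by (simp add: alg_next_def Let_def)
qed

text \<open>\<open>alg_tau\<close> is a stationary point of the Rayleigh quotient along
  \<open>v + t *\<^sub>R x\<close>; there the numerator acquires the factor
  \<open>1 + t\<^sup>2\<close> of the denominator.\<close>

lemma alg_next_increase:
  assumes lin: "linear A" and v: "norm v = 1" "norm x = 1" "x \<bullet> v = 0" and a: "alg_a A v x \<noteq> 0"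
  shows "(norm (A (alg_next A v x)))\<^sup>2 - (norm (A v))\<^sup>2 = alg_a A v x * alg_tau (alg_a A v x) (alg_b A v x)"
proof -
  define a where "a = alg_a A v x"
  define b where "b = alg_b A v x"
  define t where "t = alg_tau a b"
  have "a * (a * t\<^sup>2 - b * t - a) = 0"
    using alg_tau_root[of a b] a
    by (simp add: a_def[symmetric] t_def[symmetric] power2_eq_square algebra_simps)
  \<comment> \<open>Up to a positive factor, this is the vanishing of the derivative of the
    quotient.\<close>
  then have root: "b * t = a * t\<^sup>2 - a" using a by (simp add: a_def[symmetric])
  have pos: "1 + t\<^sup>2 > 0" using zero_le_power2[of t] by linarith
  have "A (alg_next A v x) = (A v + t *\<^sub>R A x) /\<^sub>R sqrt (1 + t\<^sup>2)"
    using lin by (simp add: alg_next_def Let_def linear_cmul linear_add t_def a_def b_def)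
  then have "(norm (A (alg_next A v x)))\<^sup>2 = (norm (A v + t *\<^sub>R A x))\<^sup>2 / (1 + t\<^sup>2)"
    using pos by (simp add: power_mult_distrib power_inverse divide_inverse_commute)
  also have "(norm (A v + t *\<^sub>R A x))\<^sup>2 = (norm (A v))\<^sup>2 + 2 * t * a + t\<^sup>2 * (norm (A x))\<^sup>2"
    unfolding power2_norm_eq_inner inner_add_left inner_add_right
    by (simp add: a_def alg_a_def inner_commute[of "A x" "A v"] power2_eq_square algebra_simps)
  also have "\<dots> = (norm (A v))\<^sup>2 * (1 + t\<^sup>2) + (2 * t * a + t * (b * t))"
    by (simp add: b_def alg_b_def power2_eq_square algebra_simps)
  also have "\<dots> = ((norm (A v))\<^sup>2 + a * t) * (1 + t\<^sup>2)"
    unfolding root by (simp add: power2_eq_square algebra_simps)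
  finally show ?thesis using pos by (simp add: a_def b_def t_def)
qed

text \<open>The gain \<open>t = a * \<tau>\<close> satisfies \<open>t * (t - b) = a\<^sup>2\<close>, and \<open>t - b \<le> (norm (A v))\<^sup>2\<close> says that
  the Gram matrix of \<open>A v\<close> and \<open>A x\<close> is positive semidefinite.\<close>

lemma alg_a_squared_le_increase:
  assumes lin: "linear A" and v: "norm v = 1" "norm x = 1" "x \<bullet> v = 0" and a: "alg_a A v x \<noteq> 0"
  shows "(alg_a A v x)\<^sup>2 \<le> (onorm A)\<^sup>2 * ((norm (A (alg_next A v x)))\<^sup>2 - (norm (A v))\<^sup>2)"
proof -
  define a where "a = alg_a A v x"
  define b where "b = alg_b A v x"
  define t where "t = a * alg_tau a b"
  have t: "t = b / 2 + sqrt (b\<^sup>2 / 4 + a\<^sup>2)"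
    using alg_tau_eq a by (simp add: t_def a_def)
  have "\<bar>b / 2\<bar> \<le> sqrt (b\<^sup>2 / 4 + a\<^sup>2)"
    by (rule real_le_rsqrt) (simp add: power_divide)
  then have t0: "t \<ge> 0" unfolding t by linarith
  have "sqrt (b\<^sup>2 / 4 + a\<^sup>2) \<le> (norm (A v))\<^sup>2 + b / 2"
  proof (rule real_le_lsqrt)
    have "a\<^sup>2 \<le> (norm (A v))\<^sup>2 * (norm (A x))\<^sup>2"
      using Cauchy_Schwarz_ineq[of "A v" "A x"] by (simp add: a_def alg_a_def power2_norm_eq_inner)
    then show "b\<^sup>2 / 4 + a\<^sup>2 \<le> ((norm (A v))\<^sup>2 + b / 2)\<^sup>2"
      by (simp add: b_def alg_b_def power2_eq_square field_simps)
    show "0 \<le> (norm (A v))\<^sup>2 + b / 2" by (simp add: b_def alg_b_def field_simps)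
  qed
  moreover have "norm (A v) \<le> onorm A"
    using onorm[OF linear_conv_bounded_linear[THEN iffD1, OF lin], of v] v by simp
  then have "(norm (A v))\<^sup>2 \<le> (onorm A)\<^sup>2" by (simp add: power_mono)
  ultimately have "t - b \<le> (onorm A)\<^sup>2" unfolding t by linarith
  then have "t * (t - b) \<le> (onorm A)\<^sup>2 * t"
    using t0 mult_right_mono[of "t - b" "(onorm A)\<^sup>2" t] by (simp add: mult.commute)
  moreover have "t * (t - b) = a\<^sup>2"
    using alg_tau_root[of a b] a by (simp add: t_def a_def)
  ultimately have "a\<^sup>2 \<le> (onorm A)\<^sup>2 * t" by simp
  then show ?thesis
    using alg_next_increase[OF assms] by (simp add: t_def a_def b_def)
qed

section \<open>Eigenspaces\<close>

text \<open>Eigenvectors of the self-adjoint map \<open>A\<^sup>* A\<close> for distinct eigenvalues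
  are orthogonal, and there are only finitely many pairwise orthogonal vectors.\<close>

lemma finite_eigenvalues:
  fixes A :: "'a::euclidean_space \<Rightarrow> 'b::euclidean_space"
  assumes "linear A"
  shows "finite {\<alpha>. \<exists>u. u \<noteq> 0 \<and> adjoint A (A u) = \<alpha> *\<^sub>R u}" (is "finite ?E")
proof -
  have "\<forall>\<alpha>\<in>?E. \<exists>u. u \<noteq> 0 \<and> adjoint A (A u) = \<alpha> *\<^sub>R u" by simp
  then obtain e where e: "\<And>\<alpha>. \<alpha> \<in> ?E \<Longrightarrow> e \<alpha> \<noteq> 0 \<and> adjoint A (A (e \<alpha>)) = \<alpha> *\<^sub>R e \<alpha>"
    unfolding bchoice_iff by blast
  have orth: "e \<alpha> \<bullet> e \<mu> = 0" if "\<alpha> \<in> ?E" "\<mu> \<in> ?E" "\<alpha> \<noteq> \<mu>" for \<alpha> \<mu>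
  proof -
    have "adjoint A (A (e \<alpha>)) \<bullet> e \<mu> = e \<alpha> \<bullet> adjoint A (A (e \<mu>))"
      by (simp add: adjoint_clauses[OF assms])
    then have "\<alpha> * (e \<alpha> \<bullet> e \<mu>) = \<mu> * (e \<alpha> \<bullet> e \<mu>)"
      using e[OF that(1)] e[OF that(2)] by simp
    then show ?thesis using that by simp
  qed
  have "pairwise orthogonal (e ` ?E)"
    using orth unfolding pairwise_image by (simp add: pairwise_def orthogonal_def)
  then have "finite (e ` ?E)" by (rule pairwise_orthogonal_imp_finite)
  moreover have "inj_on e ?E"
  proof (rule inj_onI, rule ccontr)
    fix \<alpha> \<mu> assume *: "\<alpha> \<in> ?E" "\<mu> \<in> ?E" "e \<alpha> = e \<mu>" "\<alpha> \<noteq> \<mu>"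
    then show False using orth[of \<alpha> \<mu>] e[of \<mu>] by auto
  qed
  ultimately show ?thesis by (rule finite_imageD)
qed

text \<open>The multiplicity hypothesis leaves the eigenspace codimension at least 2, so adjoining
  one vector still gives a proper subspace.\<close>

lemma negligible_span_insert_eigenspace:
  fixes A :: "real ^ 'd \<Rightarrow> real ^ 'm"
  assumes lin: "linear A"
    and mult: "\<not> (\<exists>\<sigma>. singular_value A \<sigma> \<and>
              singular_value_multiplicity A \<sigma> \<in> {CARD('d) - 1, CARD('d)})"
    and eig: "u \<noteq> 0" "adjoint A (A u) = \<alpha> *\<^sub>R u"
  shows "negligible (span (insert v {u. adjoint A (A u) = \<alpha> *\<^sub>R u}))"
proof -
  \<comment> \<open>\<open>A\<^sup>* A\<close> is positive semidefinite, so \<open>\<alpha>\<close>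
    is the square of a singular value and the hypothesis applies to it.\<close>
  have "\<alpha> * (u \<bullet> u) = adjoint A (A u) \<bullet> u" using eig by simp
  also have "\<dots> = A u \<bullet> A u" by (simp add: adjoint_clauses[OF lin])
  finally have "0 \<le> \<alpha> * (u \<bullet> u)" by simp
  moreover have "u \<bullet> u > 0" using eig by simp
  ultimately have l: "\<alpha> = (sqrt \<alpha>)\<^sup>2" "0 \<le> sqrt \<alpha>" by (auto simp: zero_le_mult_iff)
  let ?E = "{u. adjoint A (A u) = \<alpha> *\<^sub>R u}"
  have "singular_value A (sqrt \<alpha>)"
    unfolding singular_value_def using l eig by (metis)
  then have "dim ?E \<noteq> CARD('d) - 1" "dim ?E \<noteq> CARD('d)"
    using mult l by (auto simp: singular_value_multiplicity_def)
  moreover have "dim ?E \<le> CARD('d)" using dim_subset_UNIV[of ?E] by simp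
  ultimately have "dim ?E + 1 < DIM(real ^ 'd)" by simp
  then have "dim (insert v ?E) < DIM(real ^ 'd)" by (simp add: dim_insert)
  then show ?thesis by (intro negligible_lowdim) simp
qed

text \<open>If \<open>v\<close> is no eigenvector but the next iterate is, with eigenvalue \<open>\<alpha>\<close>, then the sample lies in
  the span of \<open>v\<close> and the \<open>\<alpha>\<close>-eigenspace.\<close>

lemma negligible_bad_sample:
  fixes A :: "real ^ 'd \<Rightarrow> real ^ 'm"
  assumes lin: "linear A"
    and mult: "\<not> (\<exists>\<sigma>. singular_value A \<sigma> \<and>
              singular_value_multiplicity A \<sigma> \<in> {CARD('d) - 1, CARD('d)})"
    and v: "norm v = 1" "residual A v \<noteq> 0"
  shows "negligible {z. alg_a A v (alg_x v z) = 0 \<or> residual A (alg_next A v (alg_x v z)) = 0}"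
proof -
  let ?EV = "{\<alpha>. \<exists>u. u \<noteq> 0 \<and> adjoint A (A u) = \<alpha> *\<^sub>R u}"
  \<comment> \<open>The hyperplane catches the samples with an undefined step; the finitely many
    subspaces catch those that lead to an eigenvector.\<close>
  let ?N = "{z. residual A v \<bullet> z = 0} \<union> (\<Union>\<alpha>\<in>?EV. span (insert v {u. adjoint A (A u) = \<alpha> *\<^sub>R u}))"
  have "negligible ?N"
  proof (intro negligible_Un negligible_Union)
    show "negligible {z. residual A v \<bullet> z = 0}" using v by (intro negligible_hyperplane) simp
    show "finite ((\<lambda>\<alpha>. span (insert v {u. adjoint A (A u) = \<alpha> *\<^sub>R u})) ` ?EV)"
      by (intro finite_imageI finite_eigenvalues lin)
  qed (use negligible_span_insert_eigenspace[OF lin mult] in auto)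
  moreover have "{z. alg_a A v (alg_x v z) = 0 \<or> residual A (alg_next A v (alg_x v z)) = 0} \<subseteq> ?N"
  proof safe
    fix z assume "alg_a A v (alg_x v z) = 0"
    then show "residual A v \<bullet> z = 0" using alg_a_eq_0D[OF lin v(1)] by blast
  next
    fix z assume r: "residual A (alg_next A v (alg_x v z)) = 0"
      and n: "z \<notin> (\<Union>\<alpha>\<in>?EV. span (insert v {u. adjoint A (A u) = \<alpha> *\<^sub>R u}))"
    show "residual A v \<bullet> z = 0"
    proof (cases "alg_a A v (alg_x v z) = 0")
      case True then show ?thesis using alg_a_eq_0D[OF lin v(1)] by blast
    next
      case False
      define x where "x = alg_x v z"
      define t where "t = alg_tau (alg_a A v x) (alg_b A v x)"
      define w where "w = alg_next A v x"
      have x1: "norm x = 1" using alg_a_ne_0D[OF lin] False by (simp add: x_def)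
      have xo: "x \<bullet> v = 0" using alg_x_orthogonal[OF v(1)] by (simp add: x_def)
      have w1: "norm w = 1" unfolding w_def by (rule norm_alg_next[OF lin v(1) x1 xo])
      then obtain \<alpha> where l: "adjoint A (A w) = \<alpha> *\<^sub>R w"
        using r residual_eq_0_iff_eigenvector[OF lin] by (auto simp: w_def x_def)
      let ?S = "insert v {u. adjoint A (A u) = \<alpha> *\<^sub>R u}"
      have pos: "1 + t\<^sup>2 > 0" using zero_le_power2[of t] by linarith
      have w: "w = (v + t *\<^sub>R x) /\<^sub>R sqrt (1 + t\<^sup>2)"
        by (simp add: w_def alg_next_def t_def Let_def)
      \<comment> \<open>Nonzero \<open>t\<close> allows the update to be solved for
        \<open>x\<close>, which places \<open>x\<close> in the span of \<open>w\<close> and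
        \<open>v\<close>.\<close>
      have "t \<noteq> 0"
      proof
        assume "t = 0"
        then have "w = v" by (simp add: w)
        then show False using r v(2) by (simp add: w_def x_def)
      qed
      moreover have "t *\<^sub>R x = sqrt (1 + t\<^sup>2) *\<^sub>R w - v" using pos by (simp add: w)
      ultimately have "x = (1 / t) *\<^sub>R (sqrt (1 + t\<^sup>2) *\<^sub>R w - v)"
        by (metis divide_inverse_commute inverse_eq_divide mult.right_neutral pth_1 scaleR_scaleR nonzero_eq_divide_eq)
      moreover have "w \<in> span ?S" "v \<in> span ?S" using l by (auto intro: span_base)
      ultimately have xs: "x \<in> span ?S" by (simp add: span_scale span_diff)
      define c where "c = norm (z - (z \<bullet> v) *\<^sub>R v)"
      \<comment> \<open>The normalisation is invertible, so \<open>z\<close> can be recovered from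
        \<open>x\<close> and \<open>v\<close>.\<close>
      have "c \<noteq> 0" using x1 by (auto simp: x_def alg_x_def c_def)
      then have "z = c *\<^sub>R x + (z \<bullet> v) *\<^sub>R v" by (simp add: x_def alg_x_def c_def[symmetric])
      then have "z \<in> span ?S" using xs \<open>v \<in> span ?S\<close> by (metis span_add span_scale)
      moreover have "\<alpha> \<in> ?EV" using l w1 by (auto intro!: exI[of _ w])
      ultimately show ?thesis using n by blast
    qed
  qed
  ultimately show ?thesis by (rule negligible_subset)
qed

text \<open>Normalising does not affect being an eigenvector, so bad starts lie in finitely many
  proper subspaces.\<close>

lemma negligible_bad_start:
  fixes A :: "real ^ 'd \<Rightarrow> real ^ 'm"
  assumes lin: "linear A"
    and mult: "\<not> (\<exists>\<sigma>. singular_value A \<sigma> \<and>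
              singular_value_multiplicity A \<sigma> \<in> {CARD('d) - 1, CARD('d)})"
  shows "negligible {z. z = 0 \<or> residual A (z /\<^sub>R norm z) = 0}"
proof -
  let ?EV = "{\<alpha>. \<exists>u. u \<noteq> 0 \<and> adjoint A (A u) = \<alpha> *\<^sub>R u}"
  let ?N = "{0} \<union> (\<Union>\<alpha>\<in>?EV. span {u. adjoint A (A u) = \<alpha> *\<^sub>R u})"
  have "negligible ?N"
  proof (intro negligible_Un negligible_Union)
    show "finite ((\<lambda>\<alpha>. span {u. adjoint A (A u) = \<alpha> *\<^sub>R u}) ` ?EV)"
      by (intro finite_imageI finite_eigenvalues lin)
  \<comment> \<open>Inserting the zero vector does not change the span.\<close>
  qed (use negligible_span_insert_eigenspace[OF lin mult, where v = 0] in auto)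
  moreover have "{z. z = 0 \<or> residual A (z /\<^sub>R norm z) = 0} \<subseteq> ?N"
  proof safe
    fix z assume r: "residual A (z /\<^sub>R norm z) = 0"
      and n: "z \<notin> (\<Union>\<alpha>\<in>?EV. span {u. adjoint A (A u) = \<alpha> *\<^sub>R u})"
    show "z = 0"
    proof (rule ccontr)
      assume z: "z \<noteq> 0"
      then obtain \<alpha> where "adjoint A (A (z /\<^sub>R norm z)) = \<alpha> *\<^sub>R (z /\<^sub>R norm z)"
        using r residual_eq_0_iff_eigenvector[OF lin, of "z /\<^sub>R norm z"] by auto
      then have "adjoint A (A z) /\<^sub>R norm z = (\<alpha> *\<^sub>R z) /\<^sub>R norm z"
        by (simp add: linear_cmul[OF lin] linear_cmul[OF adjoint_linear[OF lin]] mult.commute)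
      then have "adjoint A (A z) = \<alpha> *\<^sub>R z"
        using z by (metis inverse_nonzero_iff_nonzero norm_eq_zero scaleR_cancel_left)
      then have "\<alpha> \<in> ?EV" "z \<in> span {u. adjoint A (A u) = \<alpha> *\<^sub>R u}"
        using z by (auto intro: span_base)
      then show False using n by blast
    qed
  qed
  ultimately show ?thesis by (rule negligible_subset)
qed

section \<open>Rotation invariance of the Gaussian measure\<close>

lemma borel_measurable_linear:
  fixes f :: "'a::euclidean_space \<Rightarrow> 'b::euclidean_space"
  assumes "linear f"
  shows "f \<in> borel_measurable borel"
  using assms by (intro borel_measurable_continuous_onI linear_continuous_on)
    (simp add: linear_conv_bounded_linear)

lemma nn_integral_lborel_translation:
  fixes h :: "'a::euclidean_space \<Rightarrow> ennreal"
  assumes "h \<in> borel_measurable borel"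
  shows "(\<integral>\<^sup>+x. h (c + x) \<partial>lborel) = (\<integral>\<^sup>+x. h x \<partial>lborel)"
proof -
  have "(\<integral>\<^sup>+x. h x \<partial>distr lborel borel ((+) c)) = (\<integral>\<^sup>+x. h (c + x) \<partial>lborel)"
    by (rule nn_integral_distr) (use assms in auto)
  then show ?thesis by (simp add: lborel_distr_plus)
qed

text \<open>Uniqueness of Haar measure, normalised on the unit ball: by Fubini and translation invariance
  both sides agree after multiplication by the volume of the unit ball. (The library's change of
  variables for linear maps is limited to well-ordered index types.)\<close>

lemma distr_lborel_orthogonal_transformation:
  fixes f :: "'a::euclidean_space \<Rightarrow> 'a"
  assumes f: "orthogonal_transformation f"
  shows "distr lborel borel f = lborel"
proof (rule measure_eqI)
  fix S assume "S \<in> sets (distr lborel borel f)"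
  then have S [measurable]: "S \<in> sets borel" by simp
  have lin: "linear f" by (rule orthogonal_transformation_linear[OF f])
  have lin': "linear (inv f)"
    using f by (intro orthogonal_transformation_linear orthogonal_transformation_inv)
  have finv: "f (inv f x) = x" for x
    using orthogonal_transformation_surj[OF f] by (rule surj_f_inv_f)
  note [measurable] = borel_measurable_linear[OF lin] borel_measurable_linear[OF lin']
  let ?g = "indicator (ball 0 1) :: 'a \<Rightarrow> ennreal" and ?h = "indicator S :: 'a \<Rightarrow> ennreal"
  have [measurable]: "ball (0 :: 'a) 1 \<in> sets borel" by simp
  define c where "c = emeasure lborel (ball (0 :: 'a) 1)"
  have c_ball: "(\<integral>\<^sup>+x. ?g x \<partial>lborel) = c" by (simp add: c_def)
  have c: "c \<noteq> 0" "c \<noteq> \<top>"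
    using emeasure_lborel_ball_finite[of "0::'a" 1] content_ball_pos[of 1 "0::'a"] by (auto simp: c_def measure_def)
  have "c * (\<integral>\<^sup>+y. ?h y \<partial>lborel) = (\<integral>\<^sup>+x. ?g x * (\<integral>\<^sup>+y. ?h y \<partial>lborel) \<partial>lborel)"
    unfolding c_ball[symmetric] by (rule nn_integral_multc[symmetric]) measurable
  \<comment> \<open>For fixed \<open>x\<close>, the shift by \<open>f x\<close> is constant in the
    inner integral.\<close>
  also have "\<dots> = (\<integral>\<^sup>+x. ?g x * (\<integral>\<^sup>+y. ?h (f x + y) \<partial>lborel) \<partial>lborel)"
    by (subst nn_integral_lborel_translation) auto
  also have "\<dots> = (\<integral>\<^sup>+x. (\<integral>\<^sup>+y. ?g x * ?h (f x + y) \<partial>lborel) \<partial>lborel)"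
    by (intro nn_integral_cong nn_integral_cmult[symmetric]) measurable
  also have "\<dots> = (\<integral>\<^sup>+y. (\<integral>\<^sup>+x. ?g x * ?h (f x + y) \<partial>lborel) \<partial>lborel)"
    by (rule lborel_pair.Fubini'[symmetric]) measurable
  \<comment> \<open>Shifting \<open>x\<close> by \<open>- inv f y\<close> frees the argument of
    \<open>?h\<close> from \<open>y\<close>; only the ball then depends on \<open>y\<close>.\<close>
  also have "\<dots> = (\<integral>\<^sup>+y. (\<integral>\<^sup>+x. ?g (- inv f y + x) * ?h (f (- inv f y + x) + y) \<partial>lborel) \<partial>lborel)"
    by (intro nn_integral_cong nn_integral_lborel_translation[symmetric]) measurable
  also have "\<dots> = (\<integral>\<^sup>+y. (\<integral>\<^sup>+x. ?g (- f x + y) * ?h (f x) \<partial>lborel) \<partial>lborel)"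
  proof (intro nn_integral_cong arg_cong2[where f = "(*)"])
    fix x y
    have eq: "f (- inv f y + x) = f x - y"
      by (simp add: linear_diff[OF lin] finv)
    then show "?h (f (- inv f y + x) + y) = ?h (f x)" by simp
    \<comment> \<open>\<open>f\<close> is an isometry and the ball is symmetric, so the indicator of
      the ball is unchanged by passing from \<open>x - inv f y\<close> to
      \<open>y - f x\<close>.\<close>
    have "norm (- inv f y + x) = norm (- f x + y)"
      using orthogonal_transformation_norm[OF f, of "- inv f y + x"] unfolding eq by (simp add: norm_minus_commute)
    then show "?g (- inv f y + x) = ?g (- f x + y)" by (simp add: indicator_def)
  qed
  also have "\<dots> = (\<integral>\<^sup>+x. (\<integral>\<^sup>+y. ?g (- f x + y) * ?h (f x) \<partial>lborel) \<partial>lborel)"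
    by (rule lborel_pair.Fubini') measurable
  also have "\<dots> = (\<integral>\<^sup>+x. (\<integral>\<^sup>+y. ?g (- f x + y) \<partial>lborel) * ?h (f x) \<partial>lborel)"
    by (intro nn_integral_cong nn_integral_multc) measurable
  also have "\<dots> = (\<integral>\<^sup>+x. c * ?h (f x) \<partial>lborel)"
    by (subst nn_integral_lborel_translation) (simp_all add: c_ball)
  also have "\<dots> = c * (\<integral>\<^sup>+x. ?h (f x) \<partial>lborel)"
    by (rule nn_integral_cmult) measurable
  also have "(\<integral>\<^sup>+x. ?h (f x) \<partial>lborel) = (\<integral>\<^sup>+x. ?h x \<partial>distr lborel borel f)"
    by (rule nn_integral_distr[symmetric]) measurable
  finally show "emeasure (distr lborel borel f) S = emeasure lborel S"
    using c by (simp add: ennreal_mult_cancel_left)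
qed simp

section \<open>The standard Gaussian measure\<close>

definition gaussian_measure :: "(real ^ 'd) measure" where
  "gaussian_measure = density lborel (\<lambda>z. ennreal (std_gaussian_density z))"

lemma sets_gaussian_measure [measurable_cong, simp]: "sets gaussian_measure = sets borel"
  by (simp add: gaussian_measure_def)

lemma borel_measurable_std_gaussian_density [measurable]:
  "std_gaussian_density \<in> borel_measurable borel"
  unfolding std_gaussian_density_def by measurable

text \<open>The density depends on the norm alone, and Lebesgue measure is invariant.\<close>

lemma distr_gaussian_orthogonal_transformation:
  fixes f :: "real ^ 'd \<Rightarrow> real ^ 'd"
  assumes f: "orthogonal_transformation f"
  shows "distr gaussian_measure borel f = gaussian_measure"
proof -
  have [measurable]: "f \<in> borel_measurable borel"
    by (intro borel_measurable_linear orthogonal_transformation_linear[OF f])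
  have "density (distr lborel borel f) (\<lambda>z. ennreal (std_gaussian_density z))
      = distr (density lborel (\<lambda>z. ennreal (std_gaussian_density (f z)))) borel f"
    by (rule density_distr) measurable
  moreover have "std_gaussian_density (f z) = std_gaussian_density z" for z
    by (simp add: std_gaussian_density_def orthogonal_transformation_norm[OF f])
  ultimately show ?thesis
    by (simp add: gaussian_measure_def distr_lborel_orthogonal_transformation[OF f])
qed

lemma AE_gaussian_not_negligible:
  assumes "negligible {z. \<not> P z}"
  shows "AE z in gaussian_measure. P z"
proof -
  have "AE z in lebesgue. P z"
    using assms by (auto simp: eventually_ae_filter_negligible)
  then have "AE z in lborel. P z" by (simp add: AE_completion_iff)
  then show ?thesis
    unfolding gaussian_measure_def by (subst AE_density) (auto elim: eventually_mono)
qed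

lemma std_gaussian_distr:
  assumes "std_gaussian M Z"
  shows "Z \<in> borel_measurable M" "distr M borel Z = gaussian_measure"
proof -
  have d: "distributed M lborel Z (\<lambda>z. ennreal (std_gaussian_density z))"
    using assms by (simp add: std_gaussian_def)
  show "Z \<in> borel_measurable M" using distributed_measurable[OF d] by simp
  have "distr M borel Z = distr M lborel Z" by (rule distr_cong) auto
  then show "distr M borel Z = gaussian_measure"
    using distributed_distr_eq_density[OF d] by (simp add: gaussian_measure_def)
qed

text \<open>Where \<open>n = 0\<close>, division by zero makes \<open>reflect n\<close> the identity.\<close>

definition reflect :: "'a::real_inner \<Rightarrow> 'a \<Rightarrow> 'a" where
  "reflect n z = z - (2 * (z \<bullet> n) / (n \<bullet> n)) *\<^sub>R n"

lemma inner_reflect: "reflect n y \<bullet> z = y \<bullet> reflect n z"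
  by (simp add: reflect_def inner_diff_left inner_diff_right inner_commute)

lemma reflect_reflect: "reflect n (reflect n z) = z"
  by (cases "n = 0") (simp_all add: reflect_def inner_diff_left scaleR_left.add[symmetric])

lemma linear_reflect: "linear (reflect n)"
  by (rule linearI) (simp_all add: reflect_def inner_add_left algebra_simps add_divide_distrib)

lemma orthogonal_transformation_reflect: "orthogonal_transformation (reflect n)"
  by (simp add: orthogonal_transformation_def linear_reflect inner_reflect reflect_reflect)

text \<open>For vectors of equal length, the hyperplane orthogonal to \<open>b - c\<close> bisects
  them.\<close>

lemma reflect_diff:
  fixes b c :: "'a::real_inner"
  assumes "norm b = 1" "norm c = 1"
  shows "reflect (b - c) b = c"
proof (cases "b = c")
  case False
  have "2 * (b \<bullet> (b - c)) = (b - c) \<bullet> (b - c)"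
    using assms by (simp add: norm_eq_1 inner_diff_left inner_diff_right inner_commute)
  moreover have "(b - c) \<bullet> (b - c) \<noteq> 0" using False by simp
  ultimately have "2 * (b \<bullet> (b - c)) / ((b - c) \<bullet> (b - c)) = 1" using divide_self by metis
  then show ?thesis by (simp only: reflect_def scaleR_one) simp
qed (simp add: reflect_def)

text \<open>An isometry fixing \<open>w\<close> commutes with the projection along \<open>w\<close>
  and with normalisation.\<close>

lemma alg_x_orthogonal_transformation:
  assumes "orthogonal_transformation f" "f w = w"
  shows "alg_x w (f z) = f (alg_x w z)"
proof -
  have lin: "linear f" by (rule orthogonal_transformation_linear[OF assms(1)])
  have "f z \<bullet> w = z \<bullet> w"
    using assms by (metis orthogonal_transformation_def)
  then have "f z - (f z \<bullet> w) *\<^sub>R w = f (z - (z \<bullet> w) *\<^sub>R w)"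
    using assms(2) by (simp add: linear_diff[OF lin] linear_cmul[OF lin])
  then show ?thesis
    by (simp add: alg_x_def linear_cmul[OF lin] orthogonal_transformation_norm[OF assms(1)])
qed

section \<open>Second moments of the random direction\<close>

lemma borel_measurable_alg_x [measurable (raw)]:
  assumes [measurable]: "f \<in> borel_measurable M" "g \<in> borel_measurable M"
  shows "(\<lambda>x. alg_x (f x) (g x)) \<in> borel_measurable M"
  unfolding alg_x_def by measurable

text \<open>Parseval's identity.\<close>

lemma sum_inner_orthonormal_squared:
  assumes "pairwise orthogonal S" "\<And>b. b \<in> S \<Longrightarrow> norm b = 1" "span S = UNIV" "finite S"
  shows "(\<Sum>b\<in>S. (b \<bullet> x)\<^sup>2) = (norm x)\<^sup>2"
proof -
  have "x \<bullet> x = (\<Sum>b\<in>S. (x \<bullet> b) *\<^sub>R b) \<bullet> x"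
    using orthonormal_basis_expand[OF assms(1,2) _ assms(4), of x] assms(3) by simp
  also have "\<dots> = (\<Sum>b\<in>S. (b \<bullet> x)\<^sup>2)"
    unfolding inner_sum_left by (simp add: power2_eq_square inner_commute)
  finally show ?thesis by (simp only: power2_norm_eq_inner)
qed

text \<open>The direction \<open>alg_x w z\<close> is uniform on the unit sphere of the orthogonal complement of \<open>w\<close>.
  Reflections that fix \<open>w\<close> show that all its coordinates have the same second moment.\<close>

lemma integral_inner_alg_x_squared:
  fixes w g :: "real ^ 'd"
  assumes prob: "prob_space (gaussian_measure :: (real ^ 'd) measure)"
    and card: "CARD('d) \<ge> 2" and w: "norm w = 1" and gw: "g \<bullet> w = 0"
  shows "(real CARD('d) - 1) * (\<integral>z. (g \<bullet> alg_x w z)\<^sup>2 \<partial>gaussian_measure) = (norm g)\<^sup>2"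
proof -
  interpret G: prob_space "gaussian_measure :: (real ^ 'd) measure" by (rule prob)
  define I where "I b = (\<integral>z. (b \<bullet> alg_x w z)\<^sup>2 \<partial>gaussian_measure)" for b
  have intb: "integrable gaussian_measure (\<lambda>z. (b \<bullet> alg_x w z)\<^sup>2)" for b
  proof (rule G.integrable_const_bound[where B="(norm b)\<^sup>2"])
    have "\<bar>b \<bullet> alg_x w z\<bar> \<le> norm b * 1" for z
      using Cauchy_Schwarz_ineq2[of b "alg_x w z"] mult_left_mono[OF norm_alg_x_le, of "norm b" w z]
      by simp
    then show "AE z in gaussian_measure. norm ((b \<bullet> alg_x w z)\<^sup>2) \<le> (norm b)\<^sup>2"
      by (intro AE_I2) (simp add: abs_le_square_iff[symmetric])
  qed measurable
  have Ieq: "I b = I c" if "norm b = 1" "norm c = 1" "b \<bullet> w = 0" "c \<bullet> w = 0" for b c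
  proof -
    \<comment> \<open>This reflection takes \<open>b\<close> to \<open>c\<close>, and it fixes
      \<open>w\<close> because both are orthogonal to \<open>w\<close>.\<close>
    let ?R = "reflect (b - c)"
    have R: "orthogonal_transformation ?R" by (rule orthogonal_transformation_reflect)
    have Rw: "?R w = w" using that by (simp add: reflect_def inner_diff_right inner_commute)
    have [measurable]: "?R \<in> borel_measurable borel" unfolding reflect_def by measurable
    have "I b = (\<integral>z. (b \<bullet> alg_x w z)\<^sup>2 \<partial>distr gaussian_measure borel ?R)"
      by (simp add: I_def distr_gaussian_orthogonal_transformation[OF R])
    also have "\<dots> = (\<integral>z. (b \<bullet> alg_x w (?R z))\<^sup>2 \<partial>gaussian_measure)"
      by (rule integral_distr) measurable
    also have "\<dots> = I c"
      unfolding I_def alg_x_orthogonal_transformation[OF R Rw] inner_reflect[symmetric]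
      using reflect_diff[OF that(1,2)] by simp
    finally show ?thesis .
  qed
  obtain S where S: "w \<in> S" "pairwise orthogonal S" "\<And>b. b \<in> S \<Longrightarrow> norm b = 1"
    "independent S" "card S = DIM(real ^ 'd)" "span S = UNIV"
    by (rule vector_in_orthonormal_basis[OF w]) blast
  have fin: "finite S" using S(4) by (rule independent_imp_finite)
  have Sw: "b \<bullet> w = 0" if "b \<in> S - {w}" for b
    using S(1,2) that by (auto simp: pairwise_def orthogonal_def)
  have "(\<Sum>b\<in>S - {w}. I b) = (\<integral>z. (\<Sum>b\<in>S - {w}. (b \<bullet> alg_x w z)\<^sup>2) \<partial>gaussian_measure)"
    unfolding I_def by (rule Bochner_Integration.integral_sum[symmetric]) (rule intb)
  also have "\<dots> = (\<integral>z. 1 \<partial>(gaussian_measure :: (real ^ 'd) measure))"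
  proof (rule integral_cong_AE)
    \<comment> \<open>Off the line through \<open>w\<close>, which is null in dimension at least 2,
      the direction has norm 1; Parseval loses nothing without the coordinate along
      \<open>w\<close>, which is zero.\<close>
    have "negligible (span {w})"
      using card dim_le_card'[of "{w}"] by (intro negligible_lowdim) simp
    then have "negligible {z. \<not> z \<notin> span {w}}" by simp
    then have "AE z in gaussian_measure. z \<notin> span {w}" by (rule AE_gaussian_not_negligible)
    then show "AE z in gaussian_measure. (\<Sum>b\<in>S - {w}. (b \<bullet> alg_x w z)\<^sup>2) = 1"
    proof eventually_elim
      case (elim z)
      have "z \<noteq> (z \<bullet> w) *\<^sub>R w" using elim by (metis span_base span_scale singletonI)
      then have "norm (alg_x w z) = 1" by (intro norm_alg_x) (simp add: alg_x_def)
      moreover have "(\<Sum>b\<in>S. (b \<bullet> alg_x w z)\<^sup>2) = (norm (alg_x w z))\<^sup>2"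
        by (rule sum_inner_orthonormal_squared[OF S(2,3,6) fin])
      moreover have "w \<bullet> alg_x w z = 0" using alg_x_orthogonal[OF w] by (simp add: inner_commute)
      ultimately show ?case using S(1) fin by (simp add: sum_diff1)
    qed
  qed measurable
  also have "\<dots> = 1" using G.prob_space by simp
  finally have sum1: "(\<Sum>b\<in>S - {w}. I b) = 1" .
  show ?thesis
  proof (cases "g = 0")
    case False
    \<comment> \<open>By scaling, a unit vector suffices; its second moment is one of
      \<open>CARD('d) - 1\<close> equal terms with sum 1.\<close>
    define c where "c = g /\<^sub>R norm g"
    have c: "norm c = 1" "c \<bullet> w = 0" using False gw by (auto simp: c_def)
    have "(\<Sum>b\<in>S - {w}. I b) = (\<Sum>b\<in>S - {w}. I c)"
      proof (rule sum.cong)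
      fix b assume "b \<in> S - {w}"
      then show "I b = I c" using S(3)[of b] Sw[of b] c by (intro Ieq) auto
    qed simp
    then have Ic: "(real CARD('d) - 1) * I c = 1"
      using sum1 S(1,5) fin card by (simp add: card_Diff_singleton of_nat_diff)
    have "g = norm g *\<^sub>R c" using False by (simp add: c_def)
    then have "(g \<bullet> x)\<^sup>2 = (norm g)\<^sup>2 * (c \<bullet> x)\<^sup>2" for x
      by (metis inner_scaleR_left power_mult_distrib)
    then have "I g = (norm g)\<^sup>2 * I c" by (simp add: I_def)
    then have "(real CARD('d) - 1) * I g = (norm g)\<^sup>2 * ((real CARD('d) - 1) * I c)" by simp
    then show ?thesis unfolding Ic by (simp add: I_def)
  qed simp
qed

section \<open>One random step\<close>

lemma borel_measurable_alg_next [measurable (raw)]: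
  assumes [measurable]: "A \<in> borel_measurable borel" "f \<in> borel_measurable M" "g \<in> borel_measurable M"
  shows "(\<lambda>x. alg_next A (f x) (g x)) \<in> borel_measurable M"
  unfolding alg_next_def Let_def alg_tau_def alg_a_def alg_b_def by measurable

lemma borel_measurable_alg_a [measurable (raw)]:
  assumes [measurable]: "A \<in> borel_measurable borel" "f \<in> borel_measurable M" "g \<in> borel_measurable M"
  shows "(\<lambda>x. alg_a A (f x) (g x)) \<in> borel_measurable M"
  unfolding alg_a_def by measurable

lemma borel_measurable_residual:
  assumes lin: "linear A"
  shows "residual A \<in> borel_measurable borel"
proof -
  note [measurable] = borel_measurable_linear[OF lin] borel_measurable_linear[OF adjoint_linear[OF lin]]
  show ?thesis unfolding residual_def by measurable
qed

text \<open>\<open>U\<close> stands for the current iterate and \<open>Z\<close> for the fresh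
  sample. Unit length can be asked only almost surely, as earlier steps may be undefined on a null
  set.\<close>

locale sampling_step = prob_space M for M :: "'w measure" +
  fixes A :: "real ^ 'd \<Rightarrow> real ^ 'm" and U Z :: "'w \<Rightarrow> real ^ 'd"
  assumes lin: "linear A"
    and indep: "indep_var borel U borel Z"
    and gauss: "std_gaussian M Z"
    and unit: "AE \<omega> in M. norm (U \<omega>) = 1"
begin

lemma measurable_UZ [measurable]: "U \<in> borel_measurable M" "Z \<in> borel_measurable M"
  using indep indep_var_rv1 indep_var_rv2 by blast+

lemma measurable_A [measurable]: "A \<in> borel_measurable borel" "residual A \<in> borel_measurable borel"
  using lin borel_measurable_linear borel_measurable_residual by blast+

lemma prob_space_gaussian: "prob_space (gaussian_measure :: (real ^ 'd) measure)"
  using prob_space_distr[OF measurable_UZ(2)] std_gaussian_distr(2)[OF gauss] by simp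

lemma joint_distr:
  "distr M borel U \<Otimes>\<^sub>M gaussian_measure = distr M (borel \<Otimes>\<^sub>M borel) (\<lambda>\<omega>. (U \<omega>, Z \<omega>))"
  using indep unfolding indep_var_distribution_eq std_gaussian_distr(2)[OF gauss] by blast

lemma pair_prob_space_U_gaussian: "pair_prob_space (distr M borel U) (gaussian_measure :: (real ^ 'd) measure)"
proof -
  interpret U: prob_space "distr M borel U" by (rule prob_space_distr) measurable
  interpret G: prob_space "gaussian_measure :: (real ^ 'd) measure" by (rule prob_space_gaussian)
  show ?thesis ..
qed

text \<open>By independence the pair has a product law, and for almost every value of
  \<open>U\<close> the bad samples form a null set.\<close>

lemma AE_next_not_eigenvector:
  assumes mult: "\<not> (\<exists>\<sigma>. singular_value A \<sigma> \<and>
              singular_value_multiplicity A \<sigma> \<in> {CARD('d) - 1, CARD('d)})"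
    and res: "AE \<omega> in M. residual A (U \<omega>) \<noteq> 0"
  shows "AE \<omega> in M. alg_a A (U \<omega>) (alg_x (U \<omega>) (Z \<omega>)) \<noteq> 0 \<and>
    norm (alg_next A (U \<omega>) (alg_x (U \<omega>) (Z \<omega>))) = 1 \<and>
    residual A (alg_next A (U \<omega>) (alg_x (U \<omega>) (Z \<omega>))) \<noteq> 0"
proof -
  interpret P: pair_prob_space "distr M borel U" "gaussian_measure :: (real ^ 'd) measure"
    by (rule pair_prob_space_U_gaussian)
  \<comment> \<open>The unit norm of the next iterate is left out here; it is recovered at the end
    from the nonzero \<open>alg_a\<close>.\<close>
  define Q where "Q p \<longleftrightarrow> alg_a A (fst p) (alg_x (fst p) (snd p)) \<noteq> 0 \<and>
    residual A (alg_next A (fst p) (alg_x (fst p) (snd p))) \<noteq> 0" for p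
  have Qm: "{p \<in> space (borel \<Otimes>\<^sub>M borel). Q p} \<in> sets (borel \<Otimes>\<^sub>M borel)"
    unfolding Q_def by measurable
  have "AE w in distr M borel U. norm w = 1 \<and> residual A w \<noteq> 0"
    using unit res by (subst AE_distr_iff) auto
  then have ae: "AE w in distr M borel U. AE z in gaussian_measure. Q (w, z)"
  proof eventually_elim
    case (elim w)
    then show ?case
      using negligible_bad_sample[OF lin mult, of w] by (intro AE_gaussian_not_negligible) (simp add: Q_def)
  qed
  have eq: "sets (distr M borel U \<Otimes>\<^sub>M gaussian_measure) = sets (borel \<Otimes>\<^sub>M borel)"
    by (rule sets_pair_measure_cong) simp_all
  have "{p \<in> space (distr M borel U \<Otimes>\<^sub>M gaussian_measure). Q p} \<in> sets (distr M borel U \<Otimes>\<^sub>M gaussian_measure)"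
    unfolding eq sets_eq_imp_space_eq[OF eq] by (rule Qm)
  from this ae have "AE p in distr M borel U \<Otimes>\<^sub>M gaussian_measure. Q p"
    by (rule P.AE_pair_measure)
  then have "AE \<omega> in M. Q (U \<omega>, Z \<omega>)"
    unfolding joint_distr using Qm by (subst (asm) AE_distr_iff) auto
  with unit show ?thesis
  proof eventually_elim
    case (elim \<omega>)
    then show ?case
      using norm_alg_next[OF lin _ alg_a_ne_0D[OF lin] alg_x_orthogonal] by (simp add: Q_def)
  qed
qed

text \<open>Fubini integrates over the sample first, where the second moment for a fixed unit vector
  is known.\<close>

lemma expectation_alg_a_squared:
  assumes card: "CARD('d) \<ge> 2"
  shows "(real CARD('d) - 1) * expectation (\<lambda>\<omega>. (alg_a A (U \<omega>) (alg_x (U \<omega>) (Z \<omega>)))\<^sup>2)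
    = expectation (\<lambda>\<omega>. (norm (residual A (U \<omega>)))\<^sup>2)"
proof -
  interpret P: pair_prob_space "distr M borel U" "gaussian_measure :: (real ^ 'd) measure"
    by (rule pair_prob_space_U_gaussian)
  \<comment> \<open>Setting \<open>h\<close> to zero off the unit sphere makes it bounded
    everywhere, hence integrable, and changes nothing almost surely.\<close>
  define h where "h p = (if norm (fst p) = 1 then (residual A (fst p) \<bullet> alg_x (fst p) (snd p))\<^sup>2 else 0)" for p
  have hm[measurable]: "h \<in> borel_measurable (borel \<Otimes>\<^sub>M borel)" unfolding h_def by measurable
  have sets_eq: "sets (distr M borel U \<Otimes>\<^sub>M gaussian_measure) = sets (borel \<Otimes>\<^sub>M borel)"
    by (rule sets_pair_measure_cong) simp_all
  have "norm (h p) \<le> (onorm A)\<^sup>2 ^ 2" for p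
  proof (cases "norm (fst p) = 1")
    case True
    have "\<bar>residual A (fst p) \<bullet> alg_x (fst p) (snd p)\<bar> \<le> norm (residual A (fst p)) * norm (alg_x (fst p) (snd p))"
      by (rule Cauchy_Schwarz_ineq2)
    also have "\<dots> \<le> (onorm A)\<^sup>2 * 1"
      using norm_residual_le[OF lin True] norm_alg_x_le by (intro mult_mono) auto
    finally have "\<bar>residual A (fst p) \<bullet> alg_x (fst p) (snd p)\<bar>\<^sup>2 \<le> (onorm A)\<^sup>2 ^ 2"
      by (intro power_mono) auto
    then show ?thesis using True by (simp add: h_def)
  qed (simp add: h_def)
  then have "integrable (distr M borel U \<Otimes>\<^sub>M gaussian_measure) h"
    using hm by (intro P.integrable_const_bound[where B = "(onorm A)\<^sup>2 ^ 2"])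
      (auto simp: measurable_cong_sets[OF sets_eq refl])
  then have "integral\<^sup>L (distr M borel U \<Otimes>\<^sub>M gaussian_measure) h
      = (\<integral>w. (\<integral>z. h (w, z) \<partial>gaussian_measure) \<partial>distr M borel U)"
    by (rule P.integral_fst'[symmetric])
  then have "(real CARD('d) - 1) * integral\<^sup>L (distr M borel U \<Otimes>\<^sub>M gaussian_measure) h
      = (\<integral>w. (real CARD('d) - 1) * (\<integral>z. h (w, z) \<partial>gaussian_measure) \<partial>distr M borel U)"
    by simp
  also have "(\<lambda>w. (real CARD('d) - 1) * (\<integral>z. h (w, z) \<partial>gaussian_measure))
      = (\<lambda>w. if norm w = 1 then (norm (residual A w))\<^sup>2 else 0)"
    using integral_inner_alg_x_squared[OF prob_space_gaussian card _ residual_orthogonal[OF lin]]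
    by (auto simp: h_def fun_eq_iff)
  also have "(\<integral>w. (if norm w = 1 then (norm (residual A w))\<^sup>2 else 0) \<partial>distr M borel U)
      = expectation (\<lambda>\<omega>. if norm (U \<omega>) = 1 then (norm (residual A (U \<omega>)))\<^sup>2 else 0)"
    by (rule integral_distr) measurable
  also have "\<dots> = expectation (\<lambda>\<omega>. (norm (residual A (U \<omega>)))\<^sup>2)"
    using unit by (intro integral_cong_AE) (measurable, auto elim: eventually_mono)
  also have "integral\<^sup>L (distr M borel U \<Otimes>\<^sub>M gaussian_measure) h = expectation (\<lambda>\<omega>. h (U \<omega>, Z \<omega>))"
    unfolding joint_distr by (rule integral_distr) measurable
  also have "\<dots> = expectation (\<lambda>\<omega>. (alg_a A (U \<omega>) (alg_x (U \<omega>) (Z \<omega>)))\<^sup>2)"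
  proof (rule integral_cong_AE)
    show "AE \<omega> in M. h (U \<omega>, Z \<omega>) = (alg_a A (U \<omega>) (alg_x (U \<omega>) (Z \<omega>)))\<^sup>2"
      using unit
    proof eventually_elim
      case (elim \<omega>)
      then show ?case
        by (simp add: h_def alg_a_def inner_image_eq_residual[OF lin alg_x_orthogonal])
    qed
  qed measurable
  finally show ?thesis .
qed

lemma integrable_norm_image_squared:
  assumes "X \<in> borel_measurable M" "AE \<omega> in M. norm (X \<omega>) = 1"
  shows "integrable M (\<lambda>\<omega>. (norm (A (X \<omega>)))\<^sup>2)"
proof (rule integrable_const_bound[where B = "(onorm A)\<^sup>2"])
  show "AE \<omega> in M. norm ((norm (A (X \<omega>)))\<^sup>2) \<le> (onorm A)\<^sup>2"
    using assms(2)
  proof eventually_elim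
    case (elim \<omega>)
    then show ?case
      using onorm[OF linear_conv_bounded_linear[THEN iffD1, OF lin], of "X \<omega>"] by (simp add: power_mono)
  qed
qed (use assms(1) in measurable)

text \<open>Integrating the pointwise bound on \<open>alg_a\<close> turns the mean squared residual
  into an increment that can telescope.\<close>

lemma expectation_residual_le_increase:
  assumes card: "CARD('d) \<ge> 2"
    and ne: "AE \<omega> in M. alg_a A (U \<omega>) (alg_x (U \<omega>) (Z \<omega>)) \<noteq> 0"
  shows "expectation (\<lambda>\<omega>. (norm (residual A (U \<omega>)))\<^sup>2) \<le> (real CARD('d) - 1) * (onorm A)\<^sup>2 *
    (expectation (\<lambda>\<omega>. (norm (A (alg_next A (U \<omega>) (alg_x (U \<omega>) (Z \<omega>)))))\<^sup>2)
     - expectation (\<lambda>\<omega>. (norm (A (U \<omega>)))\<^sup>2))"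
proof -
  let ?a = "\<lambda>\<omega>. alg_a A (U \<omega>) (alg_x (U \<omega>) (Z \<omega>))"
  let ?N = "\<lambda>\<omega>. alg_next A (U \<omega>) (alg_x (U \<omega>) (Z \<omega>))"
  have "AE \<omega> in M. norm (?N \<omega>) = 1"
    using ne unit
  proof eventually_elim
    case (elim \<omega>)
    then show ?case using norm_alg_next[OF lin _ alg_a_ne_0D[OF lin] alg_x_orthogonal] by simp
  qed
  then have int: "integrable M (\<lambda>\<omega>. (norm (A (?N \<omega>)))\<^sup>2)" "integrable M (\<lambda>\<omega>. (norm (A (U \<omega>)))\<^sup>2)"
    using unit by (auto intro!: integrable_norm_image_squared)
  have "AE \<omega> in M. (?a \<omega>)\<^sup>2 \<le> (onorm A)\<^sup>2 * ((norm (A (?N \<omega>)))\<^sup>2 - (norm (A (U \<omega>)))\<^sup>2)"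
    using ne unit
  proof eventually_elim
    case (elim \<omega>)
    then show ?case
      using alg_a_squared_le_increase[OF lin _ alg_a_ne_0D[OF lin] alg_x_orthogonal] by simp
  qed
  then have "expectation (\<lambda>\<omega>. (?a \<omega>)\<^sup>2)
      \<le> expectation (\<lambda>\<omega>. (onorm A)\<^sup>2 * ((norm (A (?N \<omega>)))\<^sup>2 - (norm (A (U \<omega>)))\<^sup>2))"
    using int by (intro integral_mono_AE') (auto elim!: eventually_mono intro: order_trans[OF zero_le_power2])
  also have "\<dots> = (onorm A)\<^sup>2 * (expectation (\<lambda>\<omega>. (norm (A (?N \<omega>)))\<^sup>2)
      - expectation (\<lambda>\<omega>. (norm (A (U \<omega>)))\<^sup>2))"
    using int by simp
  finally have "(real CARD('d) - 1) * expectation (\<lambda>\<omega>. (?a \<omega>)\<^sup>2) \<le> (real CARD('d) - 1) *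
     ((onorm A)\<^sup>2 * (expectation (\<lambda>\<omega>. (norm (A (?N \<omega>)))\<^sup>2) - expectation (\<lambda>\<omega>. (norm (A (U \<omega>)))\<^sup>2)))"
    using card by (intro mult_left_mono) auto
  then show ?thesis using expectation_alg_a_squared[OF card] by (simp add: mult.assoc)
qed

end

section \<open>The iterates\<close>

text \<open>The iterate as a function of the samples alone: \<open>s 0\<close> is the starting
  sample and \<open>s (Suc k)\<close> the sample of step \<open>k\<close>. It is total, even where
  the algorithm is undefined.\<close>

primrec alg_iterate :: "(real ^ 'd \<Rightarrow> real ^ 'm) \<Rightarrow> (nat \<Rightarrow> real ^ 'd) \<Rightarrow> nat \<Rightarrow> real ^ 'd" where
  "alg_iterate A s 0 = s 0 /\<^sub>R norm (s 0)"
| "alg_iterate A s (Suc k) = alg_next A (alg_iterate A s k) (alg_x (alg_iterate A s k) (s (Suc k)))"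

lemma alg_iterate_cong:
  assumes "\<And>i. i \<le> k \<Longrightarrow> s i = t i"
  shows "alg_iterate A s k = alg_iterate A t k"
  using assms by (induction k) simp_all

text \<open>Only components up to \<open>k\<close> are assumed measurable, so that the lemma applies
  on the product space indexed by \<open>{..k}\<close>.\<close>

lemma borel_measurable_alg_iterate:
  assumes [measurable]: "A \<in> borel_measurable borel"
    and "\<And>i. i \<le> k \<Longrightarrow> (\<lambda>\<omega>. S \<omega> i) \<in> borel_measurable M"
  shows "(\<lambda>\<omega>. alg_iterate A (S \<omega>) k) \<in> borel_measurable M"
  using assms(2)
proof (induction k)
  case 0
  then have [measurable]: "(\<lambda>\<omega>. S \<omega> 0) \<in> borel_measurable M" by simp
  show ?case by simp
next
  case (Suc k)
  then have [measurable]: "(\<lambda>\<omega>. alg_iterate A (S \<omega>) k) \<in> borel_measurable M"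
    "(\<lambda>\<omega>. S \<omega> (Suc k)) \<in> borel_measurable M" by simp_all
  show ?case by simp
qed

text \<open>Iterate \<open>k\<close> is a function of the samples in \<open>{..k}\<close>, a block
  disjoint from \<open>{Suc k}\<close>.\<close>

lemma (in prob_space) indep_var_alg_iterate:
  assumes A: "A \<in> borel_measurable borel"
    and ind: "indep_vars (\<lambda>_. borel) X (UNIV :: nat set)"
  shows "indep_var borel (\<lambda>\<omega>. alg_iterate A (\<lambda>i. X i \<omega>) k) borel (X (Suc k))"
proof -
  have "indep_var borel ((\<lambda>s. alg_iterate A s k) \<circ> (\<lambda>\<omega>. restrict (\<lambda>i. X i \<omega>) {..k}))
      borel ((\<lambda>s. s (Suc k)) \<circ> (\<lambda>\<omega>. restrict (\<lambda>i. X i \<omega>) {Suc k}))"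
    using A by (intro indep_var_compose[OF indep_var_restrict[OF ind]]
        borel_measurable_alg_iterate measurable_component_singleton) auto
  moreover have "alg_iterate A (restrict (\<lambda>i. X i \<omega>) {..k}) k = alg_iterate A (\<lambda>i. X i \<omega>) k" for \<omega>
    by (rule alg_iterate_cong) simp
  ultimately show ?thesis by (simp add: comp_def)
qed

text \<open>Applied to a nonzero residual and its iterate, this rules out dimension 1.\<close>

lemma card_ge_2_of_orthogonal:
  fixes r w :: "real ^ 'd"
  assumes "r \<noteq> 0" "w \<noteq> 0" "r \<bullet> w = 0"
  shows "CARD('d) \<ge> 2"
proof -
  have "r \<noteq> w" using assms by auto
  moreover have "independent {r, w}"
    using assms by (intro pairwise_orthogonal_independent)
      (auto simp: pairwise_def orthogonal_def inner_commute)
  then have "card {r, w} \<le> DIM(real ^ 'd)" using independent_bound by blast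
  ultimately show ?thesis by simp
qed

section \<open>The bound on the smallest probability\<close>

theorem theorem2p27:
  fixes A :: "real ^ 'd \<Rightarrow> real ^ 'm"
    and M :: "'w measure"
    and v_hat :: "'w \<Rightarrow> real ^ 'd"
    and y v :: "nat \<Rightarrow> 'w \<Rightarrow> real ^ 'd"
    and n :: nat and \<epsilon> :: real
  assumes "linear A"
    and "\<not> (\<exists>\<sigma>. singular_value A \<sigma> \<and>
              singular_value_multiplicity A \<sigma> \<in> {CARD('d) - 1, CARD('d)})"
    and "prob_space M"
    and "generated_by_algorithm A M v_hat y v"
    and "\<epsilon> > 0"
  shows "(MIN k\<in>{0..n}. \<P>(\<omega> in M.
            (norm (adjoint A (A (v k \<omega>)) - (norm (A (v k \<omega>)))\<^sup>2 *\<^sub>R v k \<omega>))\<^sup>2 \<ge> \<epsilon>))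
         \<le> 2 * (real CARD('d) - 1) * (onorm A) ^ 4 / ((real n + 1) * \<epsilon>)"
proof -
  interpret prob_space M by fact
  note lin = assms(1) and mult = assms(2)
  note Am [measurable] = borel_measurable_linear[OF lin] and [measurable] = borel_measurable_residual[OF lin]
  \<comment> \<open>One sequence for all samples: index 0 is \<open>v_hat\<close>, and index
    \<open>Suc k\<close> is \<open>y k\<close>.\<close>
  define X where "X = case_nat v_hat y"
  have X: "std_gaussian M (X 0)" "\<And>k. std_gaussian M (X (Suc k))" "indep_vars (\<lambda>_. borel) X UNIV"
    and vm [measurable]: "\<And>k. v k \<in> borel_measurable M"
    and v0: "\<And>\<omega>. \<omega> \<in> space M \<Longrightarrow> X 0 \<omega> \<noteq> 0 \<Longrightarrow> v 0 \<omega> = X 0 \<omega> /\<^sub>R norm (X 0 \<omega>)"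
    and vSuc: "\<And>k \<omega>. \<omega> \<in> space M \<Longrightarrow> alg_a A (v k \<omega>) (alg_x (v k \<omega>) (X (Suc k) \<omega>)) \<noteq> 0 \<Longrightarrow>
      v (Suc k) \<omega> = alg_next A (v k \<omega>) (alg_x (v k \<omega>) (X (Suc k) \<omega>))"
    using assms(4) by (auto simp: generated_by_algorithm_def X_def Let_def)
  \<comment> \<open>Unlike \<open>v\<close>, which is arbitrary after an undefined step,
    \<open>u\<close> is determined by the samples and so inherits their independence.\<close>
  define u where "u k \<omega> = alg_iterate A (\<lambda>i. X i \<omega>) k" for k \<omega>
  have u_Suc: "u (Suc k) \<omega> = alg_next A (u k \<omega>) (alg_x (u k \<omega>) (X (Suc k) \<omega>))" for k \<omega>
    by (simp add: u_def)
  have ind: "indep_var borel (u k) borel (X (Suc k))" for k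
    unfolding u_def[abs_def] by (rule indep_var_alg_iterate[OF Am X(3)])
  have step: "sampling_step M A (u k) (X (Suc k))" if "AE \<omega> in M. norm (u k \<omega>) = 1" for k
    by (intro sampling_step.intro sampling_step_axioms.intro prob_space_axioms lin ind X(2) that)
  \<comment> \<open>The parts support each other: a nonzero residual makes the next step defined
    almost surely, and a defined step makes \<open>v\<close> follow \<open>u\<close>.\<close>
  have u: "AE \<omega> in M. v k \<omega> = u k \<omega> \<and> norm (u k \<omega>) = 1 \<and> residual A (u k \<omega>) \<noteq> 0" for k
  proof (induction k)
    case 0
    have "negligible {z. \<not> (z \<noteq> 0 \<and> residual A (z /\<^sub>R norm z) \<noteq> 0)}"
      using negligible_bad_start[OF lin mult] by simp
    then have "AE z in distr M borel (X 0). z \<noteq> 0 \<and> residual A (z /\<^sub>R norm z) \<noteq> 0"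
      unfolding std_gaussian_distr(2)[OF X(1)] by (rule AE_gaussian_not_negligible)
    then have "AE \<omega> in M. X 0 \<omega> \<noteq> 0 \<and> residual A (X 0 \<omega> /\<^sub>R norm (X 0 \<omega>)) \<noteq> 0"
      using std_gaussian_distr(1)[OF X(1)] by (rule AE_distrD[rotated])
    with AE_space show ?case
    proof eventually_elim
      case (elim \<omega>)
      then show ?case using v0[of \<omega>] by (simp add: u_def)
    qed
  next
    case (Suc k)
    then interpret sampling_step M A "u k" "X (Suc k)"
      by (intro step) (auto elim: eventually_mono)
    have "AE \<omega> in M. residual A (u k \<omega>) \<noteq> 0" using Suc by (auto elim: eventually_mono)
    from AE_next_not_eigenvector[OF mult this] Suc AE_space show ?case
    proof eventually_elim
      case (elim \<omega>)
      then show ?case using vSuc[of \<omega> k] by (simp add: u_Suc)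
    qed
  qed
  have unit: "AE \<omega> in M. norm (v k \<omega>) = 1" for k using u[of k] by (auto elim: eventually_mono)
  have card: "CARD('d) \<ge> 2"
  proof -
    obtain \<omega> where w: "norm (u 0 \<omega>) = 1" "residual A (u 0 \<omega>) \<noteq> 0"
      using eventually_happens'[OF ae_filter_bot u[of 0]] by blast
    moreover from w have "u 0 \<omega> \<noteq> 0" by auto
    ultimately show ?thesis using card_ge_2_of_orthogonal residual_orthogonal[OF lin] by blast
  qed
  define E where "E k = expectation (\<lambda>\<omega>. (norm (A (v k \<omega>)))\<^sup>2)" for k
  define R where "R k = expectation (\<lambda>\<omega>. (norm (residual A (v k \<omega>)))\<^sup>2)" for k
  \<comment> \<open>The one-step estimate holds for \<open>u\<close>; it carries over because
    expectations ignore null sets.\<close>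
  have R_le: "R k \<le> (real CARD('d) - 1) * (onorm A)\<^sup>2 * (E (Suc k) - E k)" for k
  proof -
    interpret sampling_step M A "u k" "X (Suc k)"
      using u[of k] by (intro step) (auto elim: eventually_mono)
    have um [measurable]: "u j \<in> borel_measurable M" for j
      using indep_var_rv1[OF ind] .
    have eqs: "AE \<omega> in M. v j \<omega> = u j \<omega>" for j using u[of j] by (auto elim: eventually_mono)
    have "R k = expectation (\<lambda>\<omega>. (norm (residual A (u k \<omega>)))\<^sup>2)"
      unfolding R_def using eqs[of k] by (intro integral_cong_AE) (measurable, auto elim: eventually_mono)
    moreover have "E j = expectation (\<lambda>\<omega>. (norm (A (u j \<omega>)))\<^sup>2)" for j
      unfolding E_def using eqs[of j] by (intro integral_cong_AE) (measurable, auto elim: eventually_mono)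
    moreover have "AE \<omega> in M. residual A (u k \<omega>) \<noteq> 0" using u[of k] by (auto elim: eventually_mono)
    then have "AE \<omega> in M. alg_a A (u k \<omega>) (alg_x (u k \<omega>) (X (Suc k) \<omega>)) \<noteq> 0"
      using AE_next_not_eigenvector[OF mult] by (auto elim: eventually_mono)
    ultimately show ?thesis
      using expectation_residual_le_increase[OF card] by (simp add: u_Suc)
  qed
  have E_bounds: "0 \<le> E k" "E k \<le> (onorm A)\<^sup>2" for k
  proof -
    have "AE \<omega> in M. (norm (A (v k \<omega>)))\<^sup>2 \<le> (onorm A)\<^sup>2"
      using unit[of k]
    proof eventually_elim
      case (elim \<omega>)
      then show ?case
        using onorm[OF linear_conv_bounded_linear[THEN iffD1, OF lin], of "v k \<omega>"] by (simp add: power_mono)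
    qed
    then have "E k \<le> expectation (\<lambda>_. (onorm A)\<^sup>2)"
      unfolding E_def by (intro integral_mono_AE') auto
    then show "E k \<le> (onorm A)\<^sup>2" by (simp add: prob_space)
    show "0 \<le> E k" unfolding E_def by simp
  qed
  define p where "p k = \<P>(\<omega> in M. (norm (residual A (v k \<omega>)))\<^sup>2 \<ge> \<epsilon>)" for k
  have markov: "\<epsilon> * p k \<le> R k" for k
  proof -
    have "integrable M (\<lambda>\<omega>. (norm (residual A (v k \<omega>)))\<^sup>2)"
    proof (rule integrable_const_bound[where B = "((onorm A)\<^sup>2)\<^sup>2"])
      show "AE \<omega> in M. norm ((norm (residual A (v k \<omega>)))\<^sup>2) \<le> ((onorm A)\<^sup>2)\<^sup>2"
        using unit[of k]
        by eventually_elim (simp only: real_norm_def abs_power2, intro power_mono norm_residual_le lin norm_ge_zero)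
    qed measurable
    then have "p k \<le> R k / \<epsilon>"
      unfolding p_def R_def using assms(5)
      by (intro integral_Markov_inequality_measure[where A = "space M"]) auto
    then show ?thesis using assms(5) by (simp add: pos_le_divide_eq mult.commute)
  qed
  \<comment> \<open>The minimum is at most the average over the \<open>n + 1\<close> indices, which
    Markov's inequality bounds by the mean residuals.\<close>
  define m where "m = (MIN k\<in>{0..n}. p k)"
  have "(real n + 1) * (\<epsilon> * m) = (\<Sum>k\<in>{0..n}. \<epsilon> * m)" by simp
  also have "\<dots> \<le> (\<Sum>k\<in>{0..n}. R k)"
  proof (rule sum_mono)
    fix k assume "k \<in> {0..n}"
    then have "m \<le> p k" unfolding m_def by (intro Min_le) auto
    then show "\<epsilon> * m \<le> R k" using markov[of k] assms(5) by (meson less_imp_le mult_left_mono order_trans)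
  qed
  also have "\<dots> \<le> (\<Sum>k\<in>{0..n}. (real CARD('d) - 1) * (onorm A)\<^sup>2 * (E (Suc k) - E k))"
    by (rule sum_mono) (rule R_le)
  \<comment> \<open>The increments telescope, and all \<open>E k\<close> lie between 0 and
    \<open>(onorm A)\<^sup>2\<close>.\<close>
  also have "\<dots> = (real CARD('d) - 1) * (onorm A)\<^sup>2 * (E (Suc n) - E 0)"
    by (simp only: sum_distrib_left[symmetric] sum_Suc_diff)
  also have "\<dots> \<le> (real CARD('d) - 1) * (onorm A)\<^sup>2 * (onorm A)\<^sup>2"
    using E_bounds[of 0] E_bounds[of "Suc n"] card by (intro mult_left_mono) auto
  also have "\<dots> = (real CARD('d) - 1) * (onorm A) ^ 4"
    by (simp add: mult.assoc power_add[symmetric])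
  \<comment> \<open>The bound is nonnegative, so doubling it only weakens it.\<close>
  also have "\<dots> \<le> 2 * ((real CARD('d) - 1) * (onorm A) ^ 4)"
    using card by simp
  finally have "m * ((real n + 1) * \<epsilon>) \<le> 2 * (real CARD('d) - 1) * (onorm A) ^ 4"
    by (simp only: mult.assoc mult.commute[of \<epsilon>] mult.left_commute[of m])
  then have "m \<le> 2 * (real CARD('d) - 1) * (onorm A) ^ 4 / ((real n + 1) * \<epsilon>)"
    using assms(5) by (simp add: pos_le_divide_eq)
  then show ?thesis by (simp add: m_def p_def residual_def)
qed

end
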